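(* Let $m$ be a positive integer. Then for every positive integer $n>\dfrac{14.4}{\left(\sqrt[m]{1.5}-1\right)^m}$ there exist a positive integer $a$ and a prime number $s$ such that $n<a^m<\frac{3n}{2}<s<2n$.
   Context: $\sqrt[m]{x}$ denotes the positive real $m$-th root of a positive real number $x$. All inequalities are strict. *)

theory Defs
  imports Complex_Main "HOL-Computational_Algebra.Primes"
begin

end

theory Submission
  imports Defs "HOL-Number_Theory.Prime_Powers"
begin

text \<open>
  The \<open>m\<close>-th power exists because the hypothesis makes the interval between the \<open>m\<close>-th roots of \<open>n\<close>
  and \<open>3 n / 2\<close> longer than 1. Since \<open>(root m 1.5 - 1) ^ m\<close> is at most \<open>1 / 2\<close>, the hypothesis also
  gives \<open>n \<ge> 29\<close>, and it remains to find a prime between \<open>3 n / 2\<close> and \<open>2 n\<close>. Following Chebyshev,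
  the logarithm of \<open>n! (n/30)! / ((n/2)! (n/3)! (n/5)!)\<close> is \<open>A n + O(ln n)\<close>; as a combination of
  values of the von Mangoldt function its coefficients are 0 or 1, and they are 1 on \<open>(n/6, n]\<close>.
  Hence it is at most \<open>\<psi>(n)\<close> and at least \<open>\<theta>(n) - \<theta>(n/6)\<close>, so asymptotically
  \<open>\<theta>(3 n / 2) \<le> 6/5 A (3 n / 2) = 9/10 (2 A n)\<close>, which is less than \<open>\<theta>(2 n)\<close>. The error terms
  are harmless from \<open>n = 20000\<close> on; below that, an explicit chain of primes suffices.
\<close>

subsection \<open>The logarithm of the factorial\<close>

text \<open>The derivative \<open>ln\<close> is nonnegative from 1 on; here this is drawn from
  \<open>ln z \<le> z - 1\<close> at \<open>z = x / y\<close>. It serves to compare rounded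
  arguments with exact quotients.\<close>

lemma xlnx_minus_x_mono:
  assumes "1 \<le> x" "x \<le> (y::real)"
  shows "x * ln x - x \<le> y * ln y - y"
proof -
  have "ln (x / y) \<le> x / y - 1" using assms by (intro ln_le_minus_one) auto
  then have "ln x - ln y \<le> x / y - 1" using assms by (simp add: ln_div)
  then have "y * (ln x - ln y) \<le> y * (x / y - 1)" using assms by (intro mult_left_mono) auto
  also have "y * (x / y - 1) = x - y" using assms by (simp add: field_simps)
  finally have "y * ln x - y * ln y \<le> x - y" by (simp add: algebra_simps)
  moreover have "x * ln x \<le> y * ln x" using assms by (intro mult_right_mono) auto
  ultimately show ?thesis by linarith
qed

text \<open>Induction: the step comes down to \<open>n * ln (1 + 1 / n) \<le> 1\<close>.\<close>

lemma ln_fact_ge: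
  assumes "n > 0"
  shows "ln (fact n) \<ge> n * ln n - n + 1"
  using assms
proof (induction n rule: nat_induct_non_zero)
  case (Suc n)
  have "ln (real (Suc n) / n) \<le> real (Suc n) / n - 1" using Suc.hyps by (intro ln_le_minus_one) auto
  then have "ln (real (Suc n)) - ln n \<le> 1 / n" using Suc.hyps by (simp add: ln_div field_simps)
  then have "n * (ln (real (Suc n)) - ln n) \<le> n * (1 / n)" by (intro mult_left_mono) auto
  then have "n * ln (real (Suc n)) - n * ln n \<le> 1" using Suc.hyps by (simp add: algebra_simps)
  moreover have "ln (fact (Suc n) :: real) = ln (real (Suc n)) + ln (fact n)"
    by (simp add: ln_mult del: of_nat_Suc)
  ultimately show ?case using Suc.IH by (simp add: algebra_simps)
qed simp

text \<open>Dually, the step comes down to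
  \<open>(n + 1) * ln (n / (n + 1)) \<le> - 1\<close>.\<close>

lemma ln_fact_le:
  assumes "n > 0"
  shows "ln (fact n) \<le> n * ln n - n + 1 + ln n"
  using assms
proof (induction n rule: nat_induct_non_zero)
  case (Suc n)
  have "ln (n / real (Suc n)) \<le> n / real (Suc n) - 1" using Suc.hyps by (intro ln_le_minus_one) auto
  then have "ln n - ln (real (Suc n)) \<le> - (1 / real (Suc n))"
    using Suc.hyps by (simp add: ln_div field_simps)
  then have "real (Suc n) * (ln n - ln (real (Suc n))) \<le> real (Suc n) * (- (1 / real (Suc n)))"
    by (intro mult_left_mono) auto
  then have "real (Suc n) * ln n - real (Suc n) * ln (real (Suc n)) \<le> - 1"
    by (simp add: algebra_simps)
  moreover have "ln (fact (Suc n) :: real) = ln (real (Suc n)) + ln (fact n)"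
    by (simp add: ln_mult del: of_nat_Suc)
  ultimately show ?case using Suc.IH by (simp add: algebra_simps)
qed simp

lemma ln_fact_div_le:
  assumes "k > 0" "k \<le> n"
  defines "x \<equiv> real n / real k"
  shows "ln (fact (n div k)) \<le> x * ln x - x + 1 + ln x"
proof -
  have pos: "n div k > 0" using assms by (simp add: div_greater_zero_iff)
  have le: "real (n div k) \<le> x" unfolding x_def by (rule of_nat_div_le_of_nat)
  have "ln (real (n div k)) \<le> ln x" using pos le by simp
  moreover have "real (n div k) * ln (n div k) - n div k \<le> x * ln x - x"
    using pos le by (intro xlnx_minus_x_mono) auto
  ultimately show ?thesis using ln_fact_le[OF pos] by linarith
qed

text \<open>Rounding down lowers the argument, so monotonicity is applied to
  \<open>n div k + 1\<close>, which is at least \<open>x\<close>; the extra factor of that larger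
  factorial costs at most \<open>ln (x + 1)\<close>.\<close>

lemma ln_fact_div_ge:
  assumes "k > 0" "k \<le> n"
  defines "x \<equiv> real n / real k"
  shows "ln (fact (n div k)) \<ge> x * ln x - x + 1 - ln (x + 1)"
proof -
  have x1: "x \<ge> 1" using assms by (simp add: x_def)
  have le: "real (n div k) \<le> x" unfolding x_def by (rule of_nat_div_le_of_nat)
  have "n < (n div k + 1) * k" using assms(1) by (simp add: dividend_less_div_times)
  then have "real n < real (n div k + 1) * real k" by (metis of_nat_less_iff of_nat_mult)
  then have ge: "x \<le> real (Suc (n div k))" using assms(1) by (simp add: x_def field_simps)
  have "ln (fact (Suc (n div k)) :: real) = ln (real (Suc (n div k))) + ln (fact (n div k))"
    by (simp add: ln_mult del: of_nat_Suc)
  moreover have "ln (real (Suc (n div k))) \<le> ln (x + 1)" using le by simp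
  moreover have "x * ln x - x \<le> real (Suc (n div k)) * ln (Suc (n div k)) - Suc (n div k)"
    using x1 ge by (intro xlnx_minus_x_mono) auto
  moreover have "ln (fact (Suc (n div k))) \<ge> real (Suc (n div k)) * ln (Suc (n div k)) - Suc (n div k) + 1"
    by (rule ln_fact_ge) simp
  ultimately show ?thesis by linarith
qed

subsection \<open>Chebyshev's factorial quotient\<close>

lemma card_multiples:
  assumes "d > 0"
  shows "card {m \<in> {1..n}. d dvd m} = n div (d::nat)"
proof -
  have "{m \<in> {1..n}. d dvd m} = (\<lambda>k. d * k) ` {1..n div d}"
  proof (intro equalityI subsetI)
    fix m assume "m \<in> {m \<in> {1..n}. d dvd m}"
    then obtain k where "m = d * k" "1 \<le> m" "m \<le> n" by auto
    with assms have "k \<in> {1..n div d}"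
      by (auto simp: less_eq_div_iff_mult_less_eq mult.commute)
    with \<open>m = d * k\<close> show "m \<in> (\<lambda>k. d * k) ` {1..n div d}" by blast
  next
    fix m assume "m \<in> (\<lambda>k. d * k) ` {1..n div d}"
    with assms show "m \<in> {m \<in> {1..n}. d dvd m}"
      by (auto simp: less_eq_div_iff_mult_less_eq mult.commute)
  qed
  moreover have "inj_on (\<lambda>k. d * k) {1..n div d}"
    using assms by (auto simp: inj_on_def)
  ultimately show ?thesis by (simp add: card_image)
qed

text \<open>Expand each \<open>ln m\<close> as the sum of \<open>mangoldt d\<close> over
  \<open>d dvd m\<close> and exchange the sums. Terms with \<open>d > n\<close> vanish, so a common
  limit \<open>N\<close> lets different factorials be combined termwise.\<close>

lemma ln_fact_eq_sum_mangoldt: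
  assumes "n \<le> N"
  shows "ln (fact n) = (\<Sum>d=1..N. mangoldt d * real (n div d))"
proof -
  have "ln (fact n :: real) = (\<Sum>m=1..n. ln (real m))"
    unfolding fact_prod of_nat_prod by (subst ln_prod) auto
  also have "\<dots> = (\<Sum>m=1..n. \<Sum>d=1..N. if d dvd m then mangoldt d else 0)"
  proof (rule sum.cong[OF refl])
    fix m assume m: "m \<in> {1..n}"
    have "ln (real m) = (\<Sum>d | d dvd m. mangoldt d)"
      using m by (subst mangoldt_sum) auto
    also have "{d. d dvd m} = {d \<in> {1..N}. d dvd m}"
      using m assms by (auto dest: dvd_imp_le intro: Suc_leI dvd_pos_nat)
    also have "(\<Sum>d \<in> {d \<in> {1..N}. d dvd m}. mangoldt d) = (\<Sum>d=1..N. if d dvd m then mangoldt d else (0::real))"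
      by (rule sum.inter_filter) simp
    finally show "ln (real m) = (\<Sum>d=1..N. if d dvd m then mangoldt d else 0)" .
  qed
  also have "\<dots> = (\<Sum>d=1..N. \<Sum>m=1..n. if d dvd m then mangoldt d else 0)"
    by (rule sum.swap)
  also have "\<dots> = (\<Sum>d=1..N. mangoldt d * real (n div d))"
  proof (rule sum.cong[OF refl])
    fix d assume "d \<in> {1..N}"
    then have "d > 0" by simp
    have "(\<Sum>m=1..n. if d dvd m then mangoldt d else (0::real)) =
          (\<Sum>m \<in> {m \<in> {1..n}. d dvd m}. mangoldt d)"
      by (subst sum.inter_filter) simp_all
    also have "\<dots> = mangoldt d * real (n div d)"
      by (subst sum_constant, subst card_multiples[OF \<open>d > 0\<close>]) simp
    finally show "(\<Sum>m=1..n. if d dvd m then mangoldt d else (0::real)) = mangoldt d * real (n div d)" .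
  qed
  finally show ?thesis .
qed

definition ln_chebyshev_quotient :: "nat \<Rightarrow> real" where
  "ln_chebyshev_quotient n =
     ln (fact n) + ln (fact (n div 30)) - ln (fact (n div 2)) - ln (fact (n div 3)) - ln (fact (n div 5))"

text \<open>At \<open>k = n div d\<close> this is the weight of \<open>mangoldt d\<close> in
  \<open>ln_chebyshev_quotient n\<close>. It is an integer because subtraction of naturals would
  truncate.\<close>

definition chebyshev_coeff :: "nat \<Rightarrow> int" where
  "chebyshev_coeff k = int k + int (k div 30) - int (k div 2) - int (k div 3) - int (k div 5)"

text \<open>Since 1 + 1/30 = 1/2 + 1/3 + 1/5, the coefficient has period 30, which leaves 30
  residues to evaluate.\<close>

lemma chebyshev_coeff_cases: "chebyshev_coeff k = 0 \<or> chebyshev_coeff k = 1"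
proof -
  define q r where "q = k div 30" and "r = k mod 30"
  have k: "k = 30 * q + r" and "r < 30" by (auto simp: q_def r_def)
  have "k div 2 = 15 * q + r div 2" "k div 3 = 10 * q + r div 3" "k div 5 = 6 * q + r div 5"
       "k div 30 = q"
    using \<open>r < 30\<close> div_mult_self1[of 2 r "15 * q"] div_mult_self1[of 3 r "10 * q"]
      div_mult_self1[of 5 r "6 * q"] by (simp_all add: k ac_simps)
  then have "chebyshev_coeff k = int r - int (r div 2) - int (r div 3) - int (r div 5)"
    by (simp add: chebyshev_coeff_def k)
  moreover have "\<forall>r\<in>{..<30::nat}. int r - int (r div 2) - int (r div 3) - int (r div 5) \<in> {0, 1}"
    by code_simp
  ultimately show ?thesis using \<open>r < 30\<close> by auto
qed

lemma chebyshev_coeff_eq_1: "1 \<le> k \<Longrightarrow> k \<le> 5 \<Longrightarrow> chebyshev_coeff k = 1"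
proof -
  assume "1 \<le> k" "k \<le> 5"
  then have "k \<in> {1,2,3,4,5}" by auto
  then show ?thesis by (auto simp: chebyshev_coeff_def)
qed

lemma ln_chebyshev_quotient_eq:
  "ln_chebyshev_quotient n = (\<Sum>d=1..n. mangoldt d * of_int (chebyshev_coeff (n div d)))"
proof -
  \<comment> \<open>Nested divisions commute, so the coefficients of all five factorials become
    functions of \<open>n div d\<close>.\<close>
  have *: "ln (fact (n div k)) = (\<Sum>d=1..n. mangoldt d * real (n div d div k))" for k
    by (subst ln_fact_eq_sum_mangoldt[of _ n]) (auto simp: div_mult2_eq[symmetric] mult.commute)
  show ?thesis
    unfolding ln_chebyshev_quotient_def * ln_fact_eq_sum_mangoldt[of n n, OF order_refl] chebyshev_coeff_def
    by (simp add: sum.distrib[symmetric] sum_subtractf[symmetric] algebra_simps)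
qed

section \<open>Chebyshev's function theta compared with the quotient\<close>

definition chebyshev_theta :: "nat \<Rightarrow> real" where
  "chebyshev_theta n = (\<Sum>p | prime p \<and> p \<le> n. ln (real p))"

lemma finite_primes_le: "finite {p::nat. prime p \<and> p \<le> n}"
  by (rule finite_subset[of _ "{..n}"]) auto

text \<open>For a prime \<open>p\<close> with \<open>n div 6 < p \<le> n\<close> the value
  \<open>n div p\<close> is between 1 and 5, so its coefficient is 1; all other terms are
  nonnegative.\<close>

lemma chebyshev_theta_diff_le:
  "chebyshev_theta n - chebyshev_theta (n div 6) \<le> ln_chebyshev_quotient n"
proof -
  have "chebyshev_theta n - chebyshev_theta (n div 6) =
        (\<Sum>p \<in> {p. prime p \<and> p \<le> n} - {p. prime p \<and> p \<le> n div 6}. ln (real p))"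
    unfolding chebyshev_theta_def
    by (rule sum_diff[symmetric]) (auto simp: finite_primes_le intro: order_trans div_le_dividend)
  also have "\<dots> = (\<Sum>p \<in> {p. prime p \<and> p \<le> n} - {p. prime p \<and> p \<le> n div 6}.
                      mangoldt p * of_int (chebyshev_coeff (n div p)))"
  proof (rule sum.cong[OF refl])
    fix p assume p: "p \<in> {p. prime p \<and> p \<le> n} - {p. prime p \<and> p \<le> n div 6}"
    then have "prime p" "p \<le> n" "\<not> p \<le> n div 6" by auto
    then have "p > 0" by (simp add: prime_gt_0_nat)
    have "1 \<le> n div p"
      using \<open>p \<le> n\<close> \<open>p > 0\<close> by (simp add: less_eq_div_iff_mult_less_eq)
    moreover have "n div p < 6"
      using \<open>\<not> p \<le> n div 6\<close> \<open>p > 0\<close>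
      by (simp add: less_eq_div_iff_mult_less_eq div_less_iff_less_mult mult.commute)
    ultimately have "chebyshev_coeff (n div p) = 1" by (intro chebyshev_coeff_eq_1) auto
    with \<open>prime p\<close> show "ln (real p) = mangoldt p * of_int (chebyshev_coeff (n div p))" by simp
  qed
  also have "\<dots> \<le> (\<Sum>d=1..n. mangoldt d * of_int (chebyshev_coeff (n div d)))"
  proof (rule sum_mono2)
    show "{p. prime p \<and> p \<le> n} - {p. prime p \<and> p \<le> n div 6} \<subseteq> {1..n}"
      by (auto simp: prime_gt_0_nat Suc_leI)
    fix d
    show "0 \<le> mangoldt d * real_of_int (chebyshev_coeff (n div d))"
      using chebyshev_coeff_cases[of "n div d"] mangoldt_nonneg[of d] by auto
  qed simp
  finally show ?thesis by (simp add: ln_chebyshev_quotient_eq)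
qed

text \<open>At most \<open>log p n\<close> positive powers of \<open>p\<close> are at most
  \<open>n\<close>, and each contributes \<open>ln p\<close>.\<close>

lemma sum_mangoldt_proper_powers_le:
  assumes p: "prime p" and "n > 0"
  shows "(\<Sum>d | d \<in> {1..n} \<and> primepow d \<and> \<not> prime d \<and> aprimedivisor d = p. mangoldt d) \<le> ln (real n)"
proof -
  define D where "D = {d. d \<in> {1..n} \<and> primepow d \<and> \<not> prime d \<and> aprimedivisor d = p}"
  define K where "K = nat \<lfloor>log p n\<rfloor>"
  have p1: "real p > 1" using prime_gt_1_nat[OF p] by simp
  have log0: "log p n \<ge> 0" using p1 \<open>n > 0\<close> by (simp add: zero_le_log_cancel_iff)
  have "D \<subseteq> (\<lambda>i. p ^ i) ` {1..K}"
  proof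
    fix d assume "d \<in> D"
    then have d: "d \<le> n" "primepow d" "aprimedivisor d = p" by (auto simp: D_def)
    then obtain i where i: "i > 0" "d = p ^ i"
      by (metis primepow_decompose multiplicity_aprimedivisor_gt_0_nat primepow_gt_Suc_0)
    have "real p ^ i \<le> real n" using d(1) i(2) by (metis of_nat_le_iff of_nat_power)
    then have "real i \<le> log p n"
      using p1 \<open>n > 0\<close> by (simp add: le_log_iff powr_realpow)
    then have "i \<le> K" unfolding K_def by linarith
    with i show "d \<in> (\<lambda>i. p ^ i) ` {1..K}" by auto
  qed
  then have "card D \<le> K" using surj_card_le[of "{1..K}" D] by auto
  have "(\<Sum>d\<in>D. mangoldt d) = (\<Sum>d\<in>D. ln (real p))"
    by (rule sum.cong) (auto simp: D_def mangoldt_def)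
  also have "\<dots> = real (card D) * ln p" by simp
  also have "\<dots> \<le> log p n * ln p"
    using \<open>card D \<le> K\<close> log0 p1 unfolding K_def by (intro mult_right_mono) (linarith, simp)
  also have "\<dots> = ln n" using p1 by (simp add: log_def)
  finally show ?thesis by (simp add: D_def)
qed

text \<open>As the coefficients are at most 1, the quotient is at most psi(n). What psi has beyond
  theta comes from proper prime powers: their bases are at most \<open>sqrt n\<close>, and each base
  contributes at most \<open>ln n\<close>.\<close>

lemma ln_chebyshev_quotient_le:
  assumes "n > 0"
  shows "ln_chebyshev_quotient n \<le> chebyshev_theta n + sqrt n * ln n"
proof -
  define Q where "Q = {d. d \<in> {1..n} \<and> primepow d \<and> \<not> prime d}"
  define R where "R = {p. prime p \<and> p \<le> nat \<lfloor>sqrt n\<rfloor>}"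
  have "ln_chebyshev_quotient n \<le> (\<Sum>d=1..n. mangoldt d)"
    unfolding ln_chebyshev_quotient_eq
  proof (rule sum_mono)
    fix d show "mangoldt d * real_of_int (chebyshev_coeff (n div d)) \<le> mangoldt d"
      using chebyshev_coeff_cases[of "n div d"] mangoldt_nonneg[of d] by auto
  qed
  also have "\<dots> = (\<Sum>d \<in> {p. prime p \<and> p \<le> n} \<union> Q. mangoldt d)"
    by (rule sum.mono_neutral_right)
       (auto simp: Q_def mangoldt_def prime_gt_0_nat Suc_leI)
  also have "\<dots> = (\<Sum>d | prime d \<and> d \<le> n. mangoldt d) + (\<Sum>d\<in>Q. mangoldt d)"
    by (rule sum.union_disjoint) (auto simp: Q_def finite_primes_le)
  also have "(\<Sum>d | prime d \<and> d \<le> n. mangoldt d) = chebyshev_theta n"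
    unfolding chebyshev_theta_def by (rule sum.cong) auto
  also have "(\<Sum>d\<in>Q. mangoldt d) \<le> sqrt n * ln n"
  proof -
    have fin: "finite Q" "finite R" by (auto simp: Q_def R_def finite_primes_le)
    have "aprimedivisor ` Q \<subseteq> R"
    proof
      fix p assume "p \<in> aprimedivisor ` Q"
      then obtain d where d: "d \<le> n" "primepow d" "\<not> prime d" "aprimedivisor d = p"
        by (auto simp: Q_def)
      then have p: "prime p" by (auto intro!: prime_aprimedivisor' simp: primepow_def prime_gt_0_nat)
      obtain i where i: "i > 0" "d = p ^ i"
        using d by (metis primepow_decompose multiplicity_aprimedivisor_gt_0_nat primepow_gt_Suc_0)
      have "i \<noteq> 1" using d(3) p i by auto
      then have "p ^ 2 \<le> p ^ i" using i p by (intro power_increasing) (auto simp: prime_gt_0_nat Suc_leI)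
      then have "p ^ 2 \<le> n" using d(1) i(2) by simp
      then have "real p ^ 2 \<le> real n" by (metis of_nat_le_iff of_nat_power)
      then have "real p \<le> sqrt n" by (simp add: real_le_rsqrt)
      then show "p \<in> R" using p by (simp add: R_def) linarith
    qed
    then have "(\<Sum>d\<in>Q. mangoldt d) = (\<Sum>p\<in>R. \<Sum>d | d \<in> Q \<and> aprimedivisor d = p. mangoldt d :: real)"
      using fin by (intro sum.group[symmetric])
    also have "\<dots> \<le> (\<Sum>p\<in>R. ln (real n))"
    proof (rule sum_mono)
      fix p assume "p \<in> R"
      then show "(\<Sum>d | d \<in> Q \<and> aprimedivisor d = p. mangoldt d) \<le> ln (real n)"
        using sum_mangoldt_proper_powers_le[of p n] assms by (simp add: Q_def R_def conj_assoc)
    qed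
    also have "\<dots> = real (card R) * ln n" by simp
    also have "\<dots> \<le> sqrt n * ln n"
    proof (rule mult_right_mono)
      have "R \<subseteq> {1..nat \<lfloor>sqrt n\<rfloor>}" by (auto simp: R_def prime_gt_0_nat Suc_leI)
      then have "card R \<le> nat \<lfloor>sqrt n\<rfloor>" using card_mono[of "{1..nat \<lfloor>sqrt n\<rfloor>}" R] by simp
      moreover have "0 \<le> sqrt n" by simp
      ultimately show "real (card R) \<le> sqrt n" by linarith
    qed (use assms in simp)
    finally show ?thesis .
  qed
  finally show ?thesis by simp
qed

section \<open>Explicit estimates for the quotient and for theta\<close>

text \<open>Chebyshev's constant, about 0.9213: the factor of \<open>n\<close> that survives when
  each factorial is replaced by \<open>x ln x - x\<close> at \<open>x = n / k\<close>.\<close>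

definition chebyshev_const :: real where
  "chebyshev_const = ln 2 / 2 + ln 3 / 3 + ln 5 / 5 - ln 30 / 30"

text \<open>Thirty times the constant is \<open>ln (2 ^ 14 * 3 ^ 9 * 5 ^ 5)\<close>, and 30 * 4/5 =
  24, so it suffices to compare the argument with \<open>3 ^ 24 \<ge> exp 24\<close>.\<close>

lemma chebyshev_const_ge: "chebyshev_const \<ge> 4 / 5"
proof -
  have "ln (30::real) = ln (2 * 3 * 5)" by simp
  then have ln30: "ln (30::real) = ln 2 + ln 3 + ln 5" by (simp only: ln_mult_pos zero_less_numeral mult_pos_pos)
  have "exp (24::real) = exp 1 ^ 24" by (simp add: exp_of_nat_mult[symmetric])
  also have "\<dots> \<le> 3 ^ 24" using exp_le by (intro power_mono) auto
  also have "\<dots> \<le> 2 ^ 14 * 3 ^ 9 * 5 ^ 5" by simp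
  finally have "24 \<le> ln (2 ^ 14 * 3 ^ 9 * 5 ^ 5 :: real)" by (subst ln_ge_iff) auto
  also have "\<dots> = 14 * ln 2 + 9 * ln 3 + 5 * ln 5"
    by (simp only: ln_mult_pos zero_less_power zero_less_numeral mult_pos_pos ln_realpow of_nat_numeral)
  finally show ?thesis unfolding chebyshev_const_def ln30 by (simp add: field_simps)
qed

text \<open>The terms in \<open>x ln x\<close> and \<open>x\<close> cancel because 1 + 1/30 = 1/2 +
  1/3 + 1/5. Up to constants, each of the five factorials leaves an error of one logarithm.\<close>

lemma ln_chebyshev_quotient_bounds:
  assumes "n \<ge> 30"
  shows "ln_chebyshev_quotient n \<le> chebyshev_const * n + 5 * ln n"
    and "ln_chebyshev_quotient n \<ge> chebyshev_const * n - 5 * ln n"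
proof -
  define x where "x = real n"
  have x: "x \<ge> 30" using assms by (simp add: x_def)
  have split: "x / k * ln (x / k) = x / k * ln x - x / k * ln k" if "k > 0" for k
    using x that by (simp add: ln_div algebra_simps)
  have le: "ln (x / k + 1) \<le> ln x" if "k \<ge> 2" for k
  proof -
    have "x / k \<le> x / 2" using x that by (intro divide_left_mono) auto
    then have "x / k + 1 \<le> x" using x by linarith
    moreover have "x / k + 1 > 0" using x that by (simp add: add_pos_pos)
    ultimately show ?thesis by simp
  qed
  have le': "ln (x / k) \<le> ln x - ln k" if "k > 0" for k using x that by (simp add: ln_div)
  have ln1: "ln (x + 1) \<le> ln x + 1"
  proof -
    have "ln ((x + 1) / x) \<le> (x + 1) / x - 1" using x by (intro ln_le_minus_one) auto
    also have "\<dots> \<le> 1" using x by (simp add: field_simps)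
    finally show ?thesis using x by (simp add: ln_div)
  qed
  note up = ln_fact_div_le[of _ n, folded x_def] and low = ln_fact_div_ge[of _ n, folded x_def]
  have C: "chebyshev_const * x = x / 2 * ln 2 + x / 3 * ln 3 + x / 5 * ln 5 - x / 30 * ln 30"
    by (simp add: chebyshev_const_def algebra_simps)
  have ln30: "ln 30 \<ge> (0::real)" "ln 2 + ln 3 + ln 5 = ln (30::real)"
    using ln_mult_pos[of 2 "3::real"] ln_mult_pos[of 6 "5::real"] by auto
  \<comment> \<open>In the lower bound \<open>ln 30\<close> appears as
    \<open>ln 2 + ln 3 + ln 5\<close>; it absorbs the constant 2 lost through the summands 1 and
    through \<open>ln1\<close>.\<close>
  have ln30': "ln 30 \<ge> (3::real)"
  proof -
    have "exp (3::real) = exp 1 ^ 3" by (simp add: exp_of_nat_mult[symmetric])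
    also have "\<dots> \<le> 3 ^ 3" using exp_le by (intro power_mono) auto
    finally show ?thesis by (subst ln_ge_iff) auto
  qed
  have up': "ln (fact (n div k)) \<le> x / k * ln x - x / k * ln k - x / k + 1 + (ln x - ln k)"
    if "k > 0" "k \<le> 30" for k
    using up[of k] split[of k] le'[of k] that assms by simp
  have low': "ln (fact (n div k)) \<ge> x / k * ln x - x / k * ln k - x / k + 1 - ln (x / k + 1)"
    if "k > 0" "k \<le> 30" for k
    using low[of k] split[of k] that assms by simp
  note u = up'[of 1, simplified] up'[of 30, simplified] up'[of 2, simplified] up'[of 3, simplified]
    up'[of 5, simplified]
  note l = low'[of 1, simplified] low'[of 30, simplified] low'[of 2, simplified] low'[of 3, simplified]
    low'[of 5, simplified]
  have "ln_chebyshev_quotient n \<le> chebyshev_const * x + 5 * ln x"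
    using u l le[of 2, simplified] le[of 3, simplified] le[of 5, simplified] ln30 C
    unfolding ln_chebyshev_quotient_def by linarith
  then show "ln_chebyshev_quotient n \<le> chebyshev_const * n + 5 * ln n" by (simp add: x_def)
  have "ln_chebyshev_quotient n \<ge> chebyshev_const * x - 5 * ln x"
    using u l le[of 30, simplified] ln1 ln30' ln30 C
    unfolding ln_chebyshev_quotient_def by linarith
  then show "ln_chebyshev_quotient n \<ge> chebyshev_const * n - 5 * ln n" by (simp add: x_def)
qed

lemma chebyshev_theta_trivial_bound: "chebyshev_theta n \<le> real n * ln (real n)"
proof -
  have "chebyshev_theta n \<le> (\<Sum>p | prime p \<and> p \<le> n. ln (real n))"
    unfolding chebyshev_theta_def
    by (rule sum_mono) (auto intro!: ln_mono simp: prime_gt_0_nat)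
  also have "\<dots> = real (card {p. prime p \<and> p \<le> n}) * ln n" by simp
  also have "\<dots> \<le> real n * ln n"
  proof (cases "n = 0")
    case False
    have "{p. prime p \<and> p \<le> n} \<subseteq> {1..n}" by (auto simp: prime_gt_0_nat Suc_leI)
    then have "card {p. prime p \<and> p \<le> n} \<le> n" using card_mono[of "{1..n}"] by fastforce
    with False show ?thesis by (intro mult_right_mono) auto
  qed simp
  finally show ?thesis .
qed

text \<open>Iterating the bound on theta(n) - theta(n/6) gives a geometric series of ratio 1/6,
  hence the factor 6/5. The logarithmic errors add up over about \<open>log 6 n\<close> rounds,
  hence the squared logarithm.\<close>

lemma chebyshev_theta_le:
  assumes "n > 0"
  shows "chebyshev_theta n \<le> 6 / 5 * chebyshev_const * n + 3 * (ln n)\<^sup>2 + 120"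
  using assms
proof (induction n rule: less_induct)
  case (less n)
  show ?case
  proof (cases "n < 30")
    case True
    have "chebyshev_theta n \<le> n * ln n" by (rule chebyshev_theta_trivial_bound)
    \<comment> \<open>This product is the additive 120 of the claim, which thus covers all
      \<open>n < 30\<close>.\<close>
    also have "\<dots> \<le> 30 * 4"
    proof (rule mult_mono)
      have "(5/2::real) ^ 4 \<le> exp 1 ^ 4"
        using exp_lower_Taylor_quadratic[of 1] by (intro power_mono) auto
      also have "\<dots> = exp 4" by (simp add: exp_of_nat_mult[symmetric])
      finally have "30 \<le> exp (4::real)" by (simp add: power_divide)
      then have "ln 30 \<le> (4::real)" by (metis ln_exp ln_mono zero_less_numeral)
      moreover have "ln (real n) \<le> ln 30" using True less.prems by simp
      ultimately show "ln (real n) \<le> 4" by linarith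
    qed (use True less.prems in auto)
    also have "\<dots> \<le> 6 / 5 * chebyshev_const * n + 3 * (ln n)\<^sup>2 + 120"
      using chebyshev_const_ge by simp
    finally show ?thesis .
  next
    case False
    define L where "L = ln (real n)"
    define l where "l = ln (6::real)"
    \<comment> \<open>The induction step needs \<open>5 * L \<le> 6 * L * l - 3 * l\<^sup>2\<close>.
      By \<open>3 * l \<le> 2 * L\<close> the right side is at least \<open>4 * L * l\<close>, so
      \<open>l \<ge> 5 / 4\<close> is enough.\<close>
    have "1.25 \<le> l"
    proof -
      have "exp (5::real) = exp 1 ^ 5" by (simp add: exp_of_nat_mult[symmetric])
      also have "\<dots> \<le> 3 ^ 5" using exp_le by (intro power_mono) auto
      also have "\<dots> \<le> 6 ^ 4" by simp
      finally have "5 \<le> ln (6 ^ 4 :: real)" by (subst ln_ge_iff) auto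
      also have "\<dots> = 4 * l" unfolding l_def by (subst ln_realpow) simp_all
      finally show ?thesis by simp
    qed
    have "3 * l \<le> 2 * L"
    proof -
      have "(6::real) ^ 3 \<le> 30 ^ 2" by simp
      also have "\<dots> \<le> real n ^ 2" using False by (intro power_mono) auto
      finally have "ln (6 ^ 3) \<le> ln (real n ^ 2)" using False by (subst ln_le_cancel_iff) auto
      moreover have "ln (6 ^ 3) = 3 * l" unfolding l_def by (subst ln_realpow) simp_all
      moreover have "ln (real n ^ 2) = 2 * L" using False unfolding L_def by (subst ln_realpow) simp_all
      ultimately show ?thesis by simp
    qed
    define k where "k = n div 6"
    have k: "k > 0" "k < n" "real k \<le> n / 6"
      using False of_nat_div_le_of_nat[of n 6, where ?'a = real] by (auto simp: k_def)
    have "ln k \<le> L - l"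
    proof -
      have "ln k \<le> ln (real n / 6)" using k by simp
      then show ?thesis using False by (simp add: ln_div L_def l_def)
    qed
    moreover have "0 \<le> ln k" using k by simp
    ultimately have "(ln k)\<^sup>2 \<le> (L - l)\<^sup>2" by (intro power_mono) auto
    have "chebyshev_theta n \<le> chebyshev_theta k + ln_chebyshev_quotient n"
      using chebyshev_theta_diff_le[of n] by (simp add: k_def)
    also have "chebyshev_theta k \<le> 6 / 5 * chebyshev_const * k + 3 * (ln k)\<^sup>2 + 120"
      using k by (intro less.IH)
    also have "6 / 5 * chebyshev_const * k \<le> 6 / 5 * chebyshev_const * (n / 6)"
      using k chebyshev_const_ge by (intro mult_left_mono) auto
    also have "(ln k)\<^sup>2 \<le> (L - l)\<^sup>2" by fact
    also have "ln_chebyshev_quotient n \<le> chebyshev_const * n + 5 * L"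
      unfolding L_def using False by (intro ln_chebyshev_quotient_bounds) auto
    also have "6 / 5 * chebyshev_const * (n / 6) + 3 * (L - l)\<^sup>2 + 120 + (chebyshev_const * n + 5 * L)
        \<le> 6 / 5 * chebyshev_const * n + 3 * L\<^sup>2 + 120"
    proof -
      have "l * (3 * l) \<le> l * (2 * L)" using \<open>3 * l \<le> 2 * L\<close> \<open>1.25 \<le> l\<close> by (intro mult_left_mono) auto
      moreover have "1.25 * L \<le> l * L" using \<open>1.25 \<le> l\<close> \<open>3 * l \<le> 2 * L\<close> by (intro mult_right_mono) auto
      ultimately show ?thesis by (simp add: power2_eq_square algebra_simps)
    qed
    finally show ?thesis by (simp add: L_def)
  qed
qed

subsection \<open>Primes between three halves and twice a number\<close>

text \<open>A composite number below \<open>(k + 1)\<^sup>2\<close> has a proper divisor in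
  \<open>[2..k]\<close>. Allowing \<open>d = p\<close> lets one list of divisors serve for primes up
  to \<open>k\<close> as well.\<close>

lemma prime_by_trial_division:
  fixes p k :: int
  assumes "k \<ge> 0" "p > 1" "p < (k + 1)\<^sup>2" "\<forall>d \<in> set [2..k]. p mod d = 0 \<longrightarrow> d = p"
  shows "prime (nat p)"
proof (rule ccontr)
  assume "\<not> prime (nat p)"
  then obtain a where a: "a dvd nat p" "a \<noteq> 1" "a \<noteq> nat p"
    using assms(2) unfolding prime_nat_iff by auto
  then obtain b where b: "nat p = a * b" by (elim dvdE)
  with a assms(2) have ab: "a > 1" "b > 1" "b \<noteq> nat p"
    by (auto simp: nat_neq_iff)
  from b have p: "p = int a * int b"
    using assms(2) by (metis nat_0_le of_nat_mult order.strict_trans zero_less_one less_imp_le)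
  have "int a \<le> k \<or> int b \<le> k"
  proof (rule ccontr)
    assume "\<not> ?thesis"
    then have "(k + 1) * (k + 1) \<le> int a * int b"
      using assms(1) by (intro mult_mono) auto
    with assms(3) show False by (simp add: p power2_eq_square)
  qed
  moreover have "d = p" if "d > 1" "d \<le> k" "p mod d = 0" for d
    using assms(4) that by auto
  moreover have "p mod int a = 0" "p mod int b = 0" by (simp_all add: p)
  ultimately show False using ab a(3) by (metis nat_int of_nat_1 of_nat_less_iff)
qed

text \<open>\<open>(2 * s + 2) div 3\<close> is 2s/3 rounded up, the least \<open>n\<close> for
  which \<open>s\<close> fails to exceed 3n/2. The next entry must already be below
  \<open>2 * n\<close> there, so the assumption on the head passes to the tail.\<close>

lemma chain_meets_interval:
  fixes n :: nat
  assumes "successively (\<lambda>s s'. s' < 2 * ((2 * s + 2) div 3)) ss" "ss \<noteq> []"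
    and "hd ss < 2 * n" "3 * n < 2 * last ss"
  shows "\<exists>s \<in> set ss. 3 * n < 2 * s \<and> s < 2 * n"
  using assms
proof (induction ss rule: induct_list012)
  case (3 s s' ss)
  show ?case
  proof (cases "3 * n < 2 * s")
    case False
    then have "(2 * s + 2) div 3 < n + 1" by (subst div_less_iff_less_mult) auto
    moreover from "3.prems"(1) have "s' < 2 * ((2 * s + 2) div 3)" by simp
    ultimately have "s' < 2 * n" by linarith
    with "3.IH"(2) "3.prems" show ?thesis by auto
  qed (use "3.prems" in auto)
qed auto

lemma prime_between_small:
  fixes n :: nat
  assumes "29 \<le> n" "n \<le> 20000"
  shows "\<exists>s. prime s \<and> 3 * n < 2 * s \<and> s < 2 * n"
proof -
  \<comment> \<open>Each entry is the largest prime below \<open>2 * n\<close> for the least \<open>n\<close> not yet covered;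
    integers rather than naturals, as \<open>code_simp\<close> computes with the latter in unary.\<close>
  define ss :: "int list" where
    "ss = [53, 71, 89, 113, 151, 199, 263, 349, 463, 617, 823, 1097,
      1459, 1933, 2557, 3407, 4523, 6029, 8039, 10711, 14281, 19037, 25373, 33829]"
  \<comment> \<open>Divisors up to 183 suffice: 184 squared is 33856, above the last entry
    33829.\<close>
  have trial: "\<forall>p \<in> set ss. p > 1 \<and> p < (183 + 1)\<^sup>2 \<and> (\<forall>d \<in> set [2..183]. p mod d = 0 \<longrightarrow> d = p)"
    unfolding ss_def by code_simp
  have "prime (nat p)" if "p \<in> set ss" for p
  proof -
    note p = bspec[OF trial that]
    show ?thesis
      by (rule prime_by_trial_division[OF _ conjunct1[OF p] conjunct1[OF conjunct2[OF p]]
            conjunct2[OF conjunct2[OF p]]]) simp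
  qed
  then have "\<forall>s \<in> set (map nat ss). prime s" by simp
  \<comment> \<open>The ends fit: 53 < 2 * 29 and 3 * 20000 < 2 * 33829.\<close>
  moreover have "\<exists>s \<in> set (map nat ss). 3 * n < 2 * s \<and> s < 2 * n"
    using assms by (intro chain_meets_interval) (simp_all add: ss_def)
  ultimately show ?thesis by blast
qed

text \<open>Without such a prime, theta would agree at \<open>2 * n\<close> and at
  \<open>3 * n div 2\<close>. The upper bound at the latter then contradicts the lower bound at the
  former.\<close>

lemma prime_between_large:
  fixes n :: nat
  assumes "20000 \<le> n"
  shows "\<exists>s. prime s \<and> 3 * n < 2 * s \<and> s < 2 * n"
proof (rule ccontr)
  assume no: "\<not> ?thesis"
  define m where "m = 3 * n div 2"
  define A where "A = chebyshev_const"
  \<comment> \<open>In terms of \<open>t\<close> the main terms are multiples of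
    \<open>t\<^sup>2\<close> and the largest error is \<open>2 * t * ln t\<close>.\<close>
  define t where "t = sqrt (real (2 * n))"
  define L where "L = ln t"
  have t2: "t\<^sup>2 = 2 * n" by (simp add: t_def)
  have "sqrt (200\<^sup>2) \<le> t" unfolding t_def using assms by (intro real_sqrt_le_mono) simp
  then have t: "t \<ge> 200" by simp
  have L2: "ln (2 * n) = 2 * L" using t t2 ln_realpow[of t 2] by (simp add: L_def)
  have L0: "0 \<le> L" using t by (simp add: L_def)
  have "{p. prime p \<and> p \<le> 2 * n} = {p. prime p \<and> p \<le> m}"
  proof (intro equalityI subsetI)
    fix p assume "p \<in> {p. prime p \<and> p \<le> 2 * n}"
    then have p: "prime p" "p \<le> 2 * n" by auto
    \<comment> \<open>Theta includes the endpoint \<open>2 * n\<close>, which the strict inequality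
      for the prime excludes.\<close>
    have "p \<noteq> 2 * n" using p(1) assms prime_product[of 2 n] by auto
    with p no have "\<not> 3 * n < 2 * p" by auto
    with p show "p \<in> {p. prime p \<and> p \<le> m}" by (auto simp: m_def)
  qed (auto simp: m_def)
  then have "chebyshev_theta (2 * n) = chebyshev_theta m" by (simp add: chebyshev_theta_def)
  also have "\<dots> \<le> 6 / 5 * A * m + 3 * (ln m)\<^sup>2 + 120"
    unfolding A_def using assms by (intro chebyshev_theta_le) (auto simp: m_def)
  also have "6 / 5 * A * m \<le> 6 / 5 * A * (3 / 4 * t\<^sup>2)"
    using chebyshev_const_ge of_nat_div_le_of_nat[of "3 * n" 2, where ?'a = real]
    by (intro mult_left_mono) (auto simp: A_def m_def t2)
  also have "(ln m)\<^sup>2 \<le> (2 * L)\<^sup>2"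
  proof (rule power_mono)
    have "m > 0" "m \<le> 2 * n" using assms by (auto simp: m_def)
    then show "0 \<le> ln m" "ln m \<le> 2 * L" unfolding L2[symmetric] by (auto simp del: of_nat_mult)
  qed
  finally have "chebyshev_theta (2 * n) \<le> 9 / 10 * A * t\<^sup>2 + 12 * L\<^sup>2 + 120"
    by (simp add: power2_eq_square)
  moreover have "A * t\<^sup>2 - 10 * L \<le> ln_chebyshev_quotient (2 * n)"
    using ln_chebyshev_quotient_bounds(2)[of "2 * n"] assms L2 t2 by (simp add: A_def)
  moreover have "ln_chebyshev_quotient (2 * n) \<le> chebyshev_theta (2 * n) + 2 * t * L"
    using ln_chebyshev_quotient_le[of "2 * n"] assms L2 by (simp add: t_def)
  moreover have "4 / 5 * t\<^sup>2 \<le> A * t\<^sup>2" using chebyshev_const_ge by (intro mult_right_mono) (auto simp: A_def)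
  ultimately have contra: "2 / 25 * t\<^sup>2 \<le> 10 * L + 12 * L\<^sup>2 + 120 + 2 * t * L" by (simp add: algebra_simps)
  \<comment> \<open>The tangent of \<open>ln\<close> at 200, with \<open>ln 200\<close> rounded up
    to 6, turns \<open>contra\<close> into a quadratic inequality in \<open>t\<close>.\<close>
  have Lt: "L \<le> 5 + t / 200"
  proof -
    have "(5/2::real) ^ 6 \<le> exp 1 ^ 6"
      using exp_lower_Taylor_quadratic[of 1] by (intro power_mono) auto
    also have "\<dots> = exp 6" by (simp add: exp_of_nat_mult[symmetric])
    finally have "200 \<le> exp (6::real)" by (simp add: power_divide)
    then have "ln 200 \<le> (6::real)" by (metis ln_exp ln_mono zero_less_numeral)
    moreover have "ln (t / 200) \<le> t / 200 - 1" using t by (intro ln_le_minus_one) auto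
    ultimately show ?thesis using t by (simp add: L_def ln_div)
  qed
  have "L\<^sup>2 \<le> (5 + t / 200)\<^sup>2" using Lt L0 by (intro power_mono)
  then have "10 * L + 12 * L\<^sup>2 + 120 + 2 * t * L \<le>
      10 * (5 + t / 200) + 12 * (5 + t / 200)\<^sup>2 + 120 + 2 * t * (5 + t / 200)"
    using Lt t by (intro add_mono mult_left_mono) auto
  with contra have "2 / 25 * t\<^sup>2 \<le>
      10 * (5 + t / 200) + 12 * (5 + t / 200)\<^sup>2 + 120 + 2 * t * (5 + t / 200)"
    by (rule order_trans)
  then have "697 * t\<^sup>2 \<le> 4700000 + 106500 * t"
    by (simp add: power2_eq_square field_simps)
  \<comment> \<open>The left side is now at least \<open>139400 * t\<close>, which would force
    \<open>t < 143\<close>.\<close>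
  moreover have "200 * t \<le> t\<^sup>2" using t by (simp add: power2_eq_square)
  ultimately show False using t by linarith
qed

section \<open>The power and the conclusion\<close>

text \<open>The last hypothesis says that the \<open>m\<close>-th roots of \<open>n\<close> and
  \<open>c * n\<close> differ by more than 1, so an integer lies strictly between them.\<close>

lemma power_between:
  fixes m n :: nat
  assumes "m > 0" "c > 1" "real n * (root m c - 1) ^ m > 1"
  shows "\<exists>a. a > 0 \<and> real n < real a ^ m \<and> real a ^ m < c * real n"
proof -
  define r where "r = root m c"
  define q where "q = root m n"
  have r: "r > 1" "r ^ m = c" using assms by (simp_all add: r_def)
  have q: "q \<ge> 0" "q ^ m = n" using assms by (simp_all add: q_def)
  have "(q * (r - 1)) ^ m > 1 ^ m" using assms q by (simp add: power_mult_distrib r_def)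
  then have gap: "q * (r - 1) > 1"
    using q r by (intro power_less_imp_less_base[of 1 m]) auto
  \<comment> \<open>The floor plus one, not the ceiling, keeps \<open>q < a\<close> strict when
    \<open>q\<close> is an integer.\<close>
  define a where "a = nat \<lfloor>q\<rfloor> + 1"
  have a: "q < a" "a \<le> q + 1" using q unfolding a_def by linarith+
  have "q ^ m < real a ^ m" using a q assms by (intro power_strict_mono) auto
  moreover have "real a ^ m < (q * r) ^ m"
    using a gap assms by (intro power_strict_mono) (auto simp: algebra_simps)
  ultimately show ?thesis using q r by (intro exI[of _ a]) (auto simp: a_def power_mult_distrib mult.commute)
qed

theorem theorem7p7:
  fixes m n :: nat
  assumes "m > 0" and "n > 0"
    and "real n > 14.4 / (root m 1.5 - 1) ^ m"
  shows "\<exists>a s :: nat. a > 0 \<and> prime s \<and>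
           real n < real a ^ m \<and> real a ^ m < 3 * real n / 2 \<and>
           3 * real n / 2 < real s \<and> real s < 2 * real n"
proof -
  define r where "r = root m 1.5"
  have r: "r > 1" "r ^ m = 1.5" using assms by (simp_all add: r_def)
  have "r ^ 1 \<le> r ^ m" using r assms(1) by (intro power_increasing) auto
  then have "r \<le> 1.5" using r by simp
  have pos: "(r - 1) ^ m > 0" using r by simp
  have "(r - 1) ^ m \<le> (r - 1) ^ 1" using r \<open>r \<le> 1.5\<close> assms(1) by (intro power_decreasing) auto
  then have le: "(r - 1) ^ m \<le> 1 / 2" using \<open>r \<le> 1.5\<close> by simp
  \<comment> \<open>Used twice: with the factor at most 1/2 it gives \<open>n > 28.8\<close>, and as
    a product above 1 it provides the gap between the roots.\<close>
  have big: "14.4 < real n * (r - 1) ^ m" using assms(3) pos by (simp add: r_def field_simps)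
  also have "\<dots> \<le> real n * (1 / 2)" using le by (intro mult_left_mono) auto
  finally have "29 \<le> n" by simp
  then obtain s where s: "prime s" "3 * n < 2 * s" "s < 2 * n"
    using prime_between_small prime_between_large by (meson linear)
  obtain a where "a > 0" "real n < real a ^ m" "real a ^ m < 1.5 * real n"
    using power_between[of m "1.5" n] assms(1) big by (auto simp: r_def)
  moreover have "3 * real n / 2 < real s" "real s < 2 * real n" using s by linarith+
  ultimately show ?thesis using s(1) by (intro exI[of _ a] exI[of _ s]) auto
qed

end
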